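(* Let $X$ be a normed linear space, $Y$ a Banach space, $G\subset X$ an open set and $f:G\to Y$ an arbitrary function (not assumed continuous). Let $D$ be the (possibly empty) set of points $x\in G$ at which the Fréchet derivative $f'(x)$ exists. Then the mapping $f':D\to L(X,Y)$, $x\mapsto f'(x)$, is of the first Baire class on $D$.
   Context: $L(X,Y)$ denotes the Banach space of bounded linear operators from $X$ to $Y$ with the operator norm; the Fréchet derivative $f'(x)$, when it exists, is an element of $L(X,Y)$. The set $D$ is equipped with the metric inherited from the norm of $X$. A function between metric spaces is of the first Baire class if it is the pointwise limit of a sequence of continuous functions (between the same two metric spaces). *)

theory Defs
  imports "HOL-Analysis.Analysis"
begin

text \<open>The metric space is the subset \<open>S\<close> with the inherited metric; functions are total on the
  ambient type, but only their values on \<open>S\<close> matter.\<close>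

definition first_Baire_class_on ::
    "'a::metric_space set \<Rightarrow> ('a \<Rightarrow> 'b::metric_space) \<Rightarrow> bool" where
  "first_Baire_class_on S g \<longleftrightarrow>
     (\<exists>F :: nat \<Rightarrow> 'a \<Rightarrow> 'b.
        (\<forall>n. continuous_on S (F n)) \<and> (\<forall>x\<in>S. (\<lambda>n. F n x) \<longlonglongrightarrow> g x))"

text \<open>For \<open>x\<close> in an open set \<open>G\<close>, differentiability of \<open>f\<close> at \<open>x\<close> depends only on the restriction
  of \<open>f\<close> to \<open>G\<close>, so the values of the total function \<open>f\<close> outside \<open>G\<close> are irrelevant.\<close>

definition differentiability_set ::
    "('a::real_normed_vector \<Rightarrow> 'b::real_normed_vector) \<Rightarrow> 'a set \<Rightarrow> 'a set" where
  "differentiability_set f G = {x \<in> G. f differentiable (at x)}"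

text \<open>The derivative as a point of the normed space of bounded linear operators; meaningful only
  where \<open>f\<close> is differentiable.\<close>

definition frechet_deriv ::
    "('a::real_normed_vector \<Rightarrow> 'b::real_normed_vector) \<Rightarrow> 'a \<Rightarrow> ('a \<Rightarrow>\<^sub>L 'b)" where
  "frechet_deriv f x = Blinfun (frechet_derivative f (at x))"

end

theory Submission
  imports Defs
begin

text \<open>Let \<open>P\<^sub>n\<^sub>,\<^sub>k\<close> be the set of points at which the linear approximation has relative error at most
  \<open>1/(n+1)\<close> at all scales below \<open>1/(k+1)\<close>. Comparing two linear approximations on a common increment
  shows that the derivative varies by at most \<open>10/(n+1)\<close> at scale \<open>1/(8(k+1))\<close> on \<open>P\<^sub>n\<^sub>,\<^sub>k\<close>, and even on its
  closure relative to \<open>D\<close>. For each \<open>N\<close>, every \<open>x \<in> D\<close> has the open neighbourhood consisting of the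
  ball of radius \<open>1/(8(N+1))\<close> minus those sets \<open>closure P\<^sub>n\<^sub>,\<^sub>N\<close>, \<open>n \<le> N\<close>, that miss \<open>x\<close>. Averaging the
  values \<open>f' x\<close> over these neighbourhoods gives a continuous function \<open>F\<^sub>N\<close>, and \<open>F\<^sub>N z\<close> is
  \<open>10/(n+1)\<close>-close to \<open>f' z\<close> as soon as \<open>z \<in> P\<^sub>n\<^sub>,\<^sub>N\<close> and \<open>n \<le> N\<close>.\<close>

section \<open>Continuous averages over a neighbourhood assignment\<close>

text \<open>\<open>m z\<close> is the least centre, in a well-ordering of the type, whose
  neighbourhood contains \<open>z\<close>. If \<open>m p\<close> strictly precedes
  \<open>m q\<close>, minimality at \<open>q\<close> excludes \<open>q\<close> from
  \<open>U (m p)\<close>.\<close>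

lemma well_founded_choice_of_neighbourhood:
  fixes U :: "'a \<Rightarrow> 'a set"
  assumes "\<And>x. x \<in> S \<Longrightarrow> x \<in> U x"
  obtains m where "\<And>z. z \<in> S \<Longrightarrow> m z \<in> S \<and> z \<in> U (m z)"
    and "\<And>p q. \<lbrakk>p \<in> S; q \<in> S; m p \<noteq> m q\<rbrakk> \<Longrightarrow> q \<notin> U (m p) \<or> p \<notin> U (m q)"
proof -
  obtain r :: "'a rel" where "well_order_on UNIV r"
    using well_order_on by blast
  then have wf: "wf (r - Id)" and tot: "total r"
    by (auto simp: well_order_on_def linear_order_on_def)
  have "\<exists>x. x \<in> S \<and> z \<in> U x \<and> (\<forall>y. (y, x) \<in> r - Id \<longrightarrow> \<not> (y \<in> S \<and> z \<in> U y))" if "z \<in> S" for z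
  proof -
    have "z \<in> {x \<in> S. z \<in> U x}"
      using that assms by simp
    then obtain x where "x \<in> {x \<in> S. z \<in> U x}"
      "\<And>y. (y, x) \<in> r - Id \<Longrightarrow> y \<notin> {x \<in> S. z \<in> U x}"
      by (rule wfE_min[OF wf]) (rule that)
    then show ?thesis
      by (intro exI[of _ x]) simp
  qed
  then have "\<forall>z\<in>S. \<exists>x. x \<in> S \<and> z \<in> U x \<and> (\<forall>y. (y, x) \<in> r - Id \<longrightarrow> \<not> (y \<in> S \<and> z \<in> U y))"
    by (intro ballI)
  then obtain m where "\<forall>z\<in>S. m z \<in> S \<and> z \<in> U (m z) \<and>
      (\<forall>y. (y, m z) \<in> r - Id \<longrightarrow> \<not> (y \<in> S \<and> z \<in> U y))"
    by (rule bchoice[THEN exE])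
  then have m: "m z \<in> S" "z \<in> U (m z)"
    and least: "\<And>y. (y, m z) \<in> r - Id \<Longrightarrow> y \<in> S \<Longrightarrow> z \<notin> U y" if "z \<in> S" for z
    using that by simp_all
  show ?thesis
  proof
    show "m z \<in> S \<and> z \<in> U (m z)" if "z \<in> S" for z
      using m that by simp
    show "q \<notin> U (m p) \<or> p \<notin> U (m q)" if "p \<in> S" "q \<in> S" "m p \<noteq> m q" for p q
    proof -
      have "(m p, m q) \<in> r - Id \<or> (m q, m p) \<in> r - Id"
        using tot that(3) by (simp add: total_on_def)
      then show ?thesis
        using least[OF that(2)] least[OF that(1)] m(1)[OF that(1)] m(1)[OF that(2)] by fast
    qed
  qed
qed

text \<open>For \<delta> > 0 a tent of height \<delta> on \<open>A\<close> that vanishes at distance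
  \<delta> from it. The empty set is a separate case because \<open>infdist\<close> to it is 0 by
  convention, which would make the tent \<delta> everywhere.\<close>

definition bump :: "real \<Rightarrow> 'a::metric_space set \<Rightarrow> 'a \<Rightarrow> real" where
  "bump \<delta> A z = (if A = {} then 0 else max 0 (\<delta> - infdist z A))"

lemma bump_nonneg: "0 \<le> bump \<delta> A z"
  by (simp add: bump_def)

lemma bump_le: "0 \<le> \<delta> \<Longrightarrow> bump \<delta> A z \<le> \<delta>"
  by (simp add: bump_def infdist_nonneg)

lemma bump_mem: "\<lbrakk>z \<in> A; 0 \<le> \<delta>\<rbrakk> \<Longrightarrow> bump \<delta> A z = \<delta>"
  by (auto simp: bump_def)

lemma bump_posD:
  assumes "bump \<delta> A z > 0"
  shows "\<exists>p\<in>A. dist p z < \<delta>"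
proof -
  have "A \<noteq> {}" "infdist z A < \<delta>"
    using assms by (auto simp: bump_def split: if_splits)
  moreover have "bdd_below (dist z ` A)"
    by (rule bdd_belowI2[of _ 0]) simp
  ultimately show ?thesis
    by (simp add: infdist_notempty cINF_less_iff dist_commute)
qed

lemma abs_bump_diff_le: "\<bar>bump \<delta> A y - bump \<delta> A z\<bar> \<le> dist y z"
  using infdist_triangle[of y A z] infdist_triangle[of z A y]
  by (auto simp: bump_def dist_commute max_def abs_if)

text \<open>The product is 1-Lipschitz at scales below \<delta>: where both bumps are positive the
  label \<open>c\<close> agrees and only the bump varies; where one bump vanishes, the other term
  has norm at most its bump. Labels off the support are thus irrelevant.\<close>

lemma continuous_on_bump_scaleR:
  fixes v :: "'i \<Rightarrow> 'b::real_normed_vector"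
  assumes \<delta>: "0 < \<delta>"
    and v: "\<And>i. norm (v i) \<le> 1"
    and c: "\<And>y z. \<lbrakk>bump \<delta> A y > 0; bump \<delta> A z > 0; dist y z < \<delta>\<rbrakk> \<Longrightarrow> c y = c z"
  shows "continuous_on S (\<lambda>z. bump \<delta> A z *\<^sub>R v (c z))"
proof -
  have *: "norm (bump \<delta> A y *\<^sub>R v (c y) - bump \<delta> A z *\<^sub>R v (c z)) \<le> dist y z"
    if d: "dist y z < \<delta>" for y z
  proof -
    have "norm (bump \<delta> A y *\<^sub>R v (c y) - bump \<delta> A z *\<^sub>R v (c z))
        \<le> \<bar>bump \<delta> A y - bump \<delta> A z\<bar> * 1"
    proof (cases "bump \<delta> A y > 0 \<and> bump \<delta> A z > 0")
      case True
      then have "c y = c z"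
        using c d by blast
      then have "norm (bump \<delta> A y *\<^sub>R v (c y) - bump \<delta> A z *\<^sub>R v (c z))
          = \<bar>bump \<delta> A y - bump \<delta> A z\<bar> * norm (v (c z))"
        by (metis norm_scaleR scaleR_left_diff_distrib)
      then show ?thesis
        using v by (metis abs_ge_zero mult_left_mono)
    next
      case False
      then have "bump \<delta> A y = 0 \<or> bump \<delta> A z = 0"
        using bump_nonneg by (metis order_le_less)
      moreover have "bump \<delta> A w * norm (v (c w)) \<le> bump \<delta> A w * 1" for w
        by (intro mult_left_mono v bump_nonneg)
      ultimately show ?thesis
        by (auto simp: bump_nonneg)
    qed
    also have "\<dots> \<le> dist y z"
      using abs_bump_diff_le by simp
    finally show ?thesis .
  qed
  show ?thesis
    unfolding continuous_on_iff
  proof (intro ballI allI impI)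
    fix x e assume "(0::real) < e"
    then show "\<exists>d>0. \<forall>x'\<in>S. dist x' x < d \<longrightarrow>
        dist (bump \<delta> A x' *\<^sub>R v (c x')) (bump \<delta> A x *\<^sub>R v (c x)) < e"
      using \<delta> * by (intro exI[of _ "min e \<delta>"]) (fastforce simp: dist_norm[where 'a='b])
  qed
qed

lemma continuous_on_suminf_geometric:
  fixes u :: "nat \<Rightarrow> 'a::topological_space \<Rightarrow> 'b::banach"
  assumes "\<And>n. continuous_on S (u n)"
    and "\<And>n z. norm (u n z) \<le> (1/2) ^ n"
  shows "continuous_on S (\<lambda>z. \<Sum>n. u n z)"
proof (rule uniform_limit_theorem)
  show "uniform_limit S (\<lambda>k z. \<Sum>n<k. u n z) (\<lambda>z. \<Sum>n. u n z) sequentially"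
    using assms(2) by (intro Weierstrass_m_test summable_geometric) auto
  show "\<forall>\<^sub>F k in sequentially. continuous_on S (\<lambda>z. \<Sum>n<k. u n z)"
    using assms(1) by (intro always_eventually allI continuous_on_sum) auto
qed auto

text \<open>This replaces a partition of unity subordinate to \<open>U\<close>. As in the proof of Stone's theorem,
  a well-ordering splits the cover into countably many layers, the pieces within one layer being
  uniformly separated. The layers are summed with geometric weights; the factor
  \<open>1 / (1 + norm (g x))\<close> makes the series converge although \<open>g\<close> may be unbounded.\<close>

lemma continuous_average_over_neighbourhoods:
  fixes U :: "'a::metric_space \<Rightarrow> 'a set" and g :: "'a \<Rightarrow> 'b::banach"
  assumes op: "\<And>x. x \<in> S \<Longrightarrow> open (U x)" and mem: "\<And>x. x \<in> S \<Longrightarrow> x \<in> U x"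
  obtains F where "continuous_on S F"
    and "\<And>z c \<epsilon>. \<lbrakk>z \<in> S; \<And>x. \<lbrakk>x \<in> S; z \<in> U x\<rbrakk> \<Longrightarrow> dist (g x) c \<le> \<epsilon>\<rbrakk> \<Longrightarrow> dist (F z) c \<le> \<epsilon>"
proof -
  obtain m where m: "\<And>z. z \<in> S \<Longrightarrow> m z \<in> S \<and> z \<in> U (m z)"
    and sep: "\<And>p q. \<lbrakk>p \<in> S; q \<in> S; m p \<noteq> m q\<rbrakk> \<Longrightarrow> q \<notin> U (m p) \<or> p \<notin> U (m q)"
    using well_founded_choice_of_neighbourhood[of S U] mem by blast
  define \<delta> where "\<delta> n = (1/2::real) ^ n" for n :: nat
  \<comment> \<open>The factor 3 forces points of \<open>A n\<close> with different labels to be at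
    least \<open>3 * \<delta> n\<close> apart. After each piece is fattened by
    \<open>\<delta> n\<close> on both sides, a gap of \<open>\<delta> n\<close> remains, as
    \<open>c_loc\<close> requires.\<close>
  define A where "A n = {p \<in> S. ball p (3 * \<delta> n) \<subseteq> U (m p)}" for n
  define b where "b n z = bump (\<delta> n) (A n) z" for n z
  \<comment> \<open>An arbitrary value where \<open>b n z = 0\<close>; it only ever occurs
    multiplied by \<open>b n z\<close>.\<close>
  define c where "c n z = m (SOME p. p \<in> A n \<and> dist p z < \<delta> n)" for n z
  have \<delta>: "0 < \<delta> n" for n
    by (simp add: \<delta>_def)
  have c: "\<exists>p\<in>A n. dist p z < \<delta> n \<and> c n z = m p" if "b n z > 0" for n z
    using someI_ex[of "\<lambda>p. p \<in> A n \<and> dist p z < \<delta> n"] bump_posD that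
    unfolding b_def c_def by blast
  have c_loc: "c n y = c n z" if yz: "b n y > 0" "b n z > 0" "dist y z < \<delta> n" for n y z
  proof (rule ccontr)
    assume ne: "c n y \<noteq> c n z"
    obtain p q where p: "p \<in> A n" "dist p y < \<delta> n" "c n y = m p"
      and q: "q \<in> A n" "dist q z < \<delta> n" "c n z = m q"
      using c yz(1,2) by meson
    have "dist p q < 3 * \<delta> n"
      using p q yz(3) dist_triangle[of p q y] dist_triangle[of y q z] by (simp add: dist_commute)
    then show False
      using sep[of p q] ne p q by (auto simp: A_def dist_commute subset_iff)
  qed
  have c_U: "c n z \<in> S \<and> z \<in> U (c n z)" if bz: "b n z > 0" for n z
  proof -
    obtain p where p: "p \<in> A n" "dist p z < \<delta> n" "c n z = m p"
      using c bz by meson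
    then show ?thesis
      using m[of p] \<delta>[of n] by (auto simp: A_def subset_iff)
  qed
  define w where "w n z = b n z / (1 + norm (g (c n z)))" for n z
  have w_nonneg: "0 \<le> w n z" for n z
    by (simp add: w_def b_def bump_nonneg)
  have b_le: "0 \<le> b n z" "b n z \<le> (1/2) ^ n" for n z
    by (simp_all add: b_def \<delta>_def bump_nonneg bump_le)
  \<comment> \<open>The value space is left general: the real weights and the weighted values of
    \<open>g\<close> are both instances.\<close>
  have cont: "continuous_on S (\<lambda>z. b n z *\<^sub>R v (c n z))"
    if "\<And>i. norm (v i) \<le> 1" for n and v :: "'a \<Rightarrow> 'c::real_normed_vector"
    using continuous_on_bump_scaleR[of "\<delta> n" v "A n" "c n" S] \<delta> that c_loc unfolding b_def by blast
  have bound: "norm (b n z *\<^sub>R v (c n z)) \<le> (1/2) ^ n"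
    if "\<And>i. norm (v i) \<le> 1" for n z and v :: "'a \<Rightarrow> 'c::real_normed_vector"
    using mult_mono[OF b_le(2)[of n z] that[of "c n z"]] b_le by simp
  define v where "v x = 1 / (1 + norm (g x))" for x
  define V where "V x = v x *\<^sub>R g x" for x
  have v1: "norm (v x) \<le> 1" and V1: "norm (V x) \<le> 1" for x
    using add_pos_nonneg[OF zero_less_one norm_ge_zero[of "g x"]]
    by (simp_all add: v_def V_def)
  have w: "w n z = b n z *\<^sub>R v (c n z)" and wg: "w n z *\<^sub>R g (c n z) = b n z *\<^sub>R V (c n z)" for n z
    by (simp_all add: w_def v_def V_def)
  have cont_w: "continuous_on S (\<lambda>z. \<Sum>n. w n z)"
    unfolding w by (rule continuous_on_suminf_geometric[OF cont[OF v1] bound[OF v1]])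
  have cont_wg: "continuous_on S (\<lambda>z. \<Sum>n. w n z *\<^sub>R g (c n z))"
    unfolding wg by (rule continuous_on_suminf_geometric[OF cont[OF V1] bound[OF V1]])
  have sum_w: "summable (\<lambda>n. w n z)" for z
    unfolding w by (rule summable_comparison_test'[OF summable_geometric bound[OF v1]]) simp
  have sum_wg: "summable (\<lambda>n. w n z *\<^sub>R g (c n z))" for z
    unfolding wg by (rule summable_comparison_test'[OF summable_geometric bound[OF V1]]) simp
  \<comment> \<open>Since \<open>U (m z)\<close> is open, \<open>z\<close> lies in
    \<open>A n\<close> for every fine enough scale, so some layer has positive weight at
    \<open>z\<close>.\<close>
  have pos: "(\<Sum>n. w n z) > 0" if z: "z \<in> S" for z
  proof -
    obtain e where e: "e > 0" "ball z e \<subseteq> U (m z)"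
      using op m[OF z] openE by blast
    obtain n where "(1/2) ^ n < e / 3"
      using real_arch_pow_inv[of "e / 3" "1/2"] e by auto
    then have "ball z (3 * \<delta> n) \<subseteq> ball z e"
      by (auto simp: \<delta>_def)
    then have "z \<in> A n"
      using e z by (auto simp: A_def)
    then have "b n z > 0"
      using \<delta>[of n] by (simp add: b_def bump_mem)
    then have "w n z > 0"
      by (simp add: w_def add_pos_nonneg)
    then show ?thesis
      using suminf_pos_iff[OF sum_w] w_nonneg by blast
  qed
  \<comment> \<open>A weighted mean: positive weight at \<open>z\<close> goes only to centres
    \<open>x\<close> with \<open>z \<in> U x\<close>, so a closed ball containing all those
    \<open>g x\<close> also contains \<open>F z\<close>.\<close>
  define F where "F z = (\<Sum>n. w n z *\<^sub>R g (c n z)) /\<^sub>R (\<Sum>n. w n z)" for z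
  show ?thesis
  proof
    show "continuous_on S F"
      unfolding F_def using pos
      by (intro continuous_on_scaleR continuous_on_inverse cont_w cont_wg) fastforce
    show "dist (F z) a \<le> \<epsilon>"
      if z: "z \<in> S" and a: "\<And>x. \<lbrakk>x \<in> S; z \<in> U x\<rbrakk> \<Longrightarrow> dist (g x) a \<le> \<epsilon>" for z a \<epsilon>
    proof -
      let ?W = "\<Sum>n. w n z"
      have summand: "norm (w n z *\<^sub>R g (c n z) - w n z *\<^sub>R a) \<le> w n z * \<epsilon>" for n
      proof (cases "b n z > 0")
        case True
        then have "norm (g (c n z) - a) \<le> \<epsilon>"
          using a c_U by (simp add: dist_norm)
        then show ?thesis
          using w_nonneg by (simp add: scaleR_diff_right[symmetric] mult_left_mono)
      next
        case False
        then have "w n z = 0"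
          using b_le(1)[of n z] by (simp add: w_def)
        then show ?thesis
          by simp
      qed
      have "(\<Sum>n. w n z *\<^sub>R g (c n z)) - ?W *\<^sub>R a = (\<Sum>n. w n z *\<^sub>R g (c n z) - w n z *\<^sub>R a)"
        by (simp add: suminf_diff[OF sum_wg summable_scaleR_left[OF sum_w]]
            suminf_scaleR_left[OF sum_w])
      also have "norm \<dots> \<le> (\<Sum>n. w n z * \<epsilon>)"
        by (rule norm_suminf_le[OF summand summable_mult2[OF sum_w]])
      also have "\<dots> = ?W * \<epsilon>"
        by (rule suminf_mult2[OF sum_w, symmetric])
      finally have *: "norm ((\<Sum>n. w n z *\<^sub>R g (c n z)) - ?W *\<^sub>R a) \<le> ?W * \<epsilon>" .
      have "F z - a = ((\<Sum>n. w n z *\<^sub>R g (c n z)) - ?W *\<^sub>R a) /\<^sub>R ?W"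
        using pos[OF z] by (simp add: F_def scaleR_diff_right)
      then have "norm (F z - a) = norm ((\<Sum>n. w n z *\<^sub>R g (c n z)) - ?W *\<^sub>R a) / ?W"
        using pos[OF z] by (simp add: divide_inverse mult.commute)
      also have "\<dots> \<le> \<epsilon>"
        using * pos[OF z] by (simp add: divide_le_eq mult.commute)
      finally show ?thesis
        by (simp add: dist_norm)
    qed
  qed
qed

section \<open>Oscillation of the derivative\<close>

text \<open>By homogeneity. A sphere of small radius is used because the linear approximations are
  controlled only for small increments.\<close>

lemma norm_blinfun_bound_sphere:
  fixes T :: "'a::real_normed_vector \<Rightarrow>\<^sub>L 'b::real_normed_vector"
  assumes "0 < s" "0 \<le> c" and T: "\<And>u. norm u = s \<Longrightarrow> norm (T u) \<le> c * s"
  shows "norm T \<le> c"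
proof (rule norm_blinfun_bound[OF \<open>0 \<le> c\<close>])
  fix x show "norm (T x) \<le> c * norm x"
  proof (cases "x = 0")
    case False
    have "norm (T ((s / norm x) *\<^sub>R x)) \<le> c * s"
      using assms False by (intro T) simp
    then show ?thesis
      using False \<open>0 < s\<close> by (simp add: blinfun.scaleR_right field_simps)
  qed simp
qed

text \<open>With \<eta> = 1/(n+1) and \<delta> = 1/(k+1) this is
  \<open>P\<^sub>n\<^sub>,\<^sub>k\<close>. Here \<open>f'\<close> is any family of operators, and
  membership does not entail differentiability.\<close>

definition approx_points ::
    "('a::real_normed_vector \<Rightarrow> 'b::real_normed_vector) \<Rightarrow> ('a \<Rightarrow> 'a \<Rightarrow>\<^sub>L 'b) \<Rightarrow> real \<Rightarrow> real \<Rightarrow> 'a set" where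
  "approx_points f f' \<eta> \<delta> =
     {x. \<forall>y. norm (y - x) < \<delta> \<longrightarrow> norm (f y - f x - f' x (y - x)) \<le> \<eta> * norm (y - x)}"

lemma approx_pointsD:
  "\<lbrakk>x \<in> approx_points f f' \<eta> \<delta>; norm (y - x) < \<delta>\<rbrakk> \<Longrightarrow>
    norm (f y - f x - f' x (y - x)) \<le> \<eta> * norm (y - x)"
  by (simp add: approx_points_def)

lemma approx_points_mono: "\<delta>' \<le> \<delta> \<Longrightarrow> approx_points f f' \<eta> \<delta> \<subseteq> approx_points f f' \<eta> \<delta>'"
  by (auto simp: approx_points_def)

lemma has_derivative_imp_approx_points:
  fixes f' :: "'a::real_normed_vector \<Rightarrow> 'a \<Rightarrow>\<^sub>L 'b::real_normed_vector"
  assumes "(f has_derivative f' x) (at x)" "0 < \<eta>"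
  shows "\<exists>\<delta>>0. x \<in> approx_points f f' \<eta> \<delta>"
  using assms unfolding has_derivative_at_alt approx_points_def by blast

text \<open>For \<open>norm u = \<delta> / 2\<close> the increments from \<open>x\<close> to
  \<open>y + u\<close>, from \<open>x\<close> to \<open>y\<close> and from \<open>y\<close> to
  \<open>y + u\<close> are combined so that all values of \<open>f\<close> cancel. The errors
  \<eta>\<delta>, \<eta>\<delta>/2, \<eta>\<delta>/2 add up to 4\<eta> times the radius
  \<delta>/2.\<close>

lemma approx_points_deriv_close:
  fixes f :: "'a::real_normed_vector \<Rightarrow> 'b::real_normed_vector" and f' :: "'a \<Rightarrow> 'a \<Rightarrow>\<^sub>L 'b"
  assumes x: "x \<in> approx_points f f' \<eta> \<delta>" and y: "y \<in> approx_points f f' \<eta> \<delta>"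
    and "dist x y < \<delta> / 2" "0 \<le> \<eta>"
  shows "norm (f' x - f' y) \<le> 4 * \<eta>"
proof (rule norm_blinfun_bound_sphere)
  have d: "norm (y - x) < \<delta> / 2"
    using assms by (simp add: dist_norm norm_minus_commute)
  show "0 < \<delta> / 2"
    using d norm_ge_zero[of "y - x"] by linarith
  show "0 \<le> 4 * \<eta>"
    using assms by simp
  fix u :: 'a assume u: "norm u = \<delta> / 2"
  have tri: "norm (y - x + u) \<le> norm (y - x) + norm u"
    by (rule norm_triangle_ineq)
  let ?a = "f (y + u) - f x - f' x (y + u - x)"
  let ?b = "f y - f x - f' x (y - x)"
  let ?c = "f (y + u) - f y - f' y (y + u - y)"
  have a: "norm ?a \<le> \<eta> * norm (y + u - x)"
    by (rule approx_pointsD[OF x]) (use tri d u in \<open>simp add: algebra_simps\<close>)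
  also have "\<dots> \<le> \<eta> * \<delta>"
    using tri d u assms by (intro mult_left_mono) (simp_all add: algebra_simps)
  finally have a: "norm ?a \<le> \<eta> * \<delta>" .
  have "norm ?b \<le> \<eta> * norm (y - x)"
    by (rule approx_pointsD[OF x]) (use d norm_ge_zero[of "y - x"] in linarith)
  also have "\<dots> \<le> \<eta> * (\<delta> / 2)"
    using d assms by (intro mult_left_mono) simp_all
  finally have b: "norm ?b \<le> \<eta> * (\<delta> / 2)" .
  have c: "norm ?c \<le> \<eta> * (\<delta> / 2)"
    using approx_pointsD[OF y, of "y + u"] u d norm_ge_zero[of "y - x"] by simp
  have "(f' x - f' y) u = ?c - (?a - ?b)"
    by (simp add: blinfun.diff_left blinfun.diff_right blinfun.add_right)
  also have "norm \<dots> \<le> norm ?c + (norm ?a + norm ?b)"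
    by (rule order_trans[OF norm_triangle_ineq4 add_left_mono[OF norm_triangle_ineq4]])
  also have "\<dots> \<le> 4 * \<eta> * (\<delta> / 2)"
    using a b c by linarith
  finally show "norm ((f' x - f' y) u) \<le> 4 * \<eta> * (\<delta> / 2)" .
qed

text \<open>Only continuity of \<open>f\<close> at \<open>x\<close> is available, so the increments from points \<open>y\<close> tending to
  \<open>x\<close> are taken towards the fixed point \<open>x + u\<close>.\<close>

lemma closure_approx_points_deriv_close:
  fixes f :: "'a::real_normed_vector \<Rightarrow> 'b::real_normed_vector" and f' :: "'a \<Rightarrow> 'a \<Rightarrow>\<^sub>L 'b"
  assumes f': "(f has_derivative f' x) (at x)"
    and x: "x \<in> closure (approx_points f f' \<eta> \<delta>)" and p: "p \<in> approx_points f f' \<eta> \<delta>"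
    and "dist x p < \<delta> / 4" and "0 \<le> \<eta>"
  shows "norm (f' x - f' p) \<le> 5 * \<eta>"
proof (rule field_le_epsilon)
  fix e :: real assume e: "0 < e"
  have \<delta>: "0 < \<delta>"
    using \<open>dist x p < \<delta> / 4\<close> zero_le_dist[of x p] by linarith
  obtain y where y: "\<And>n. y n \<in> approx_points f f' \<eta> \<delta>" and lim: "y \<longlonglongrightarrow> x"
    using x unfolding closure_sequential by blast
  have near: "\<forall>\<^sub>F n in sequentially. dist (y n) x < \<delta> / 4"
    using tendstoD[OF lim, of "\<delta> / 4"] \<delta> by simp
  \<comment> \<open>The operators \<open>f' (y n)\<close> need not converge, so each is replaced by
    the fixed \<open>f' p\<close> before the limit. This costs 4\<eta> on top of the error \<eta> at
    \<open>y n\<close>.\<close>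
  have approx: "norm (f (x + u) - f x - f' p u) \<le> 5 * \<eta> * norm u" if u: "norm u < \<delta> / 2" for u
  proof (rule tendsto_le[OF sequentially_bot])
    have "isCont f x"
      using f' has_derivative_continuous by blast
    then have fy: "(\<lambda>n. f (y n)) \<longlonglongrightarrow> f x"
      using lim by (rule isCont_tendsto_compose)
    have "(\<lambda>n. norm (f (x + u) - f (y n) - f' p (x + u - y n)))
        \<longlonglongrightarrow> norm (f (x + u) - f x - f' p (x + u - x))"
      by (intro tendsto_intros fy lim)
    then show "(\<lambda>n. norm (f (x + u) - f (y n) - f' p (x + u - y n)))
        \<longlonglongrightarrow> norm (f (x + u) - f x - f' p u)"
      by simp
    have "(\<lambda>n. 5 * \<eta> * norm (x + u - y n)) \<longlonglongrightarrow> 5 * \<eta> * norm (x + u - x)"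
      by (intro tendsto_intros lim)
    then show "(\<lambda>n. 5 * \<eta> * norm (x + u - y n)) \<longlonglongrightarrow> 5 * \<eta> * norm u"
      by simp
    show "\<forall>\<^sub>F n in sequentially. norm (f (x + u) - f (y n) - f' p (x + u - y n))
        \<le> 5 * \<eta> * norm (x + u - y n)"
      using near
    proof eventually_elim
      case (elim n)
      let ?h = "x + u - y n"
      have "norm ?h \<le> norm (x - y n) + norm u"
        by (metis add_diff_eq add.commute diff_add_eq norm_triangle_ineq)
      then have "norm ?h < \<delta>"
        using elim u \<delta> by (simp add: dist_norm norm_minus_commute)
      then have 1: "norm (f (x + u) - f (y n) - f' (y n) ?h) \<le> \<eta> * norm ?h"
        by (rule approx_pointsD[OF y])
      have "dist (y n) p < \<delta> / 2"
        using elim assms(4) dist_triangle[of "y n" p x] by linarith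
      then have "norm (f' (y n) - f' p) \<le> 4 * \<eta>"
        using approx_points_deriv_close[OF y p] assms by blast
      then have 2: "norm ((f' (y n) - f' p) ?h) \<le> 4 * \<eta> * norm ?h"
        by (meson mult_right_mono norm_blinfun norm_ge_zero order_trans)
      have "f (x + u) - f (y n) - f' p ?h
          = (f (x + u) - f (y n) - f' (y n) ?h) + (f' (y n) - f' p) ?h"
        by (simp add: blinfun.diff_left)
      also have "norm \<dots> \<le> \<eta> * norm ?h + 4 * \<eta> * norm ?h"
        by (intro norm_triangle_le add_mono 1 2)
      finally show ?case
        by simp
    qed
  qed
  \<comment> \<open>Differentiability at \<open>x\<close> itself now brings in \<open>f' x\<close>
    with error \<open>e\<close>; the radius \<open>s\<close> is small enough for both approximations
    of the increment \<open>u\<close>.\<close>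
  obtain d where d: "0 < d" "x \<in> approx_points f f' e d"
    using has_derivative_imp_approx_points[of f f', OF f' e] by blast
  define s where "s = min d (\<delta> / 2) / 2"
  have s: "0 < s" "s < d" "s < \<delta> / 2"
    using d \<delta> by (auto simp: s_def)
  show "norm (f' x - f' p) \<le> 5 * \<eta> + e"
  proof (rule norm_blinfun_bound_sphere[OF s(1)])
    show "0 \<le> 5 * \<eta> + e"
      using e assms by simp
    fix u :: 'a assume u: "norm u = s"
    have "(f' x - f' p) u = (f (x + u) - f x - f' p u) - (f (x + u) - f x - f' x u)"
      by (simp add: blinfun.diff_left)
    also have "norm \<dots> \<le> 5 * \<eta> * s + e * s"
      using approx[of u] approx_pointsD[OF d(2), of "x + u"] u s
      by (intro norm_triangle_le_diff[OF add_mono]) auto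
    finally show "norm ((f' x - f' p) u) \<le> (5 * \<eta> + e) * s"
      by (simp add: distrib_right)
  qed
qed

text \<open>Both points are compared with one genuine member \<open>p\<close> of the set, chosen
  within \<delta>/8 of \<open>x\<close> and hence within \<delta>/4 of \<open>z\<close>; each
  comparison costs 5\<eta>.\<close>

lemma deriv_oscillation_on_closure_approx_points:
  fixes f :: "'a::real_normed_vector \<Rightarrow> 'b::real_normed_vector" and f' :: "'a \<Rightarrow> 'a \<Rightarrow>\<^sub>L 'b"
  assumes "(f has_derivative f' x) (at x)" "(f has_derivative f' z) (at z)"
    and "x \<in> closure (approx_points f f' \<eta> \<delta>)" "z \<in> closure (approx_points f f' \<eta> \<delta>)"
    and "dist x z < \<delta> / 8" and "0 \<le> \<eta>"
  shows "dist (f' x) (f' z) \<le> 10 * \<eta>"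
proof -
  have "0 < \<delta> / 8"
    using assms(5) zero_le_dist[of x z] by linarith
  then obtain p where p: "p \<in> approx_points f f' \<eta> \<delta>" "dist p x < \<delta> / 8"
    using assms(3) unfolding closure_approachable by blast
  have "dist x p < \<delta> / 4" "dist z p < \<delta> / 4"
    using p assms(5) dist_triangle[of z p x] \<open>0 < \<delta> / 8\<close> by (auto simp: dist_commute)
  then have "dist (f' x) (f' p) \<le> 5 * \<eta>" "dist (f' z) (f' p) \<le> 5 * \<eta>"
    using closure_approx_points_deriv_close[OF assms(1) assms(3) p(1)]
      closure_approx_points_deriv_close[OF assms(2) assms(4) p(1)] assms(6)
    by (simp_all add: dist_norm)
  then show ?thesis
    using dist_triangle2[of "f' x" "f' z" "f' p"] by linarith
qed

section \<open>The derivative is of the first Baire class\<close>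

lemma first_Baire_class_on_derivative:
  fixes f :: "'a::real_normed_vector \<Rightarrow> 'b::banach" and f' :: "'a \<Rightarrow> 'a \<Rightarrow>\<^sub>L 'b"
  assumes deriv: "\<And>x. x \<in> S \<Longrightarrow> (f has_derivative f' x) (at x)"
  shows "first_Baire_class_on S f'"
proof -
  define r where "r n = inverse (real (Suc n))" for n :: nat
  have r: "0 < r n" for n
    by (simp add: r_def)
  have r_anti: "r n \<le> r k" if "k \<le> n" for n k
    using that by (simp add: r_def le_imp_inverse_le)
  have r_small: "\<exists>n. r n < e" if "0 < e" for e
    using reals_Archimedean[OF that] by (simp add: r_def)
  define C where "C n k = closure (approx_points f f' (r n) (r k))" for n k
  \<comment> \<open>Only finitely many closed sets are removed, so \<open>U N x\<close> is open. The
    removal means that \<open>z \<in> U N x\<close> and \<open>z \<in> C n N\<close> with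
    \<open>n \<le> N\<close> force \<open>x \<in> C n N\<close>.\<close>
  define U where "U N x = ball x (r N / 8) - \<Union>{C n N |n. n \<le> N \<and> x \<notin> C n N}" for N x
  have "\<exists>F. continuous_on S F \<and> (\<forall>z c \<epsilon>. z \<in> S \<longrightarrow>
      (\<forall>x. x \<in> S \<longrightarrow> z \<in> U N x \<longrightarrow> dist (f' x) c \<le> \<epsilon>) \<longrightarrow> dist (F z) c \<le> \<epsilon>)" for N
  proof (rule continuous_average_over_neighbourhoods[of S "U N" f'])
    show "open (U N x)" for x
      unfolding U_def by (intro open_Diff open_ball closed_Union) (auto simp: C_def)
    show "x \<in> U N x" for x
      using r by (auto simp: U_def)
  qed blast
  then obtain F where contF: "\<And>N. continuous_on S (F N)"
    and F: "\<And>N z c \<epsilon>. \<lbrakk>z \<in> S; \<And>x. \<lbrakk>x \<in> S; z \<in> U N x\<rbrakk> \<Longrightarrow> dist (f' x) c \<le> \<epsilon>\<rbrakk>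
      \<Longrightarrow> dist (F N z) c \<le> \<epsilon>"
    by metis
  have "(\<lambda>N. F N z) \<longlonglongrightarrow> f' z" if z: "z \<in> S" for z
    unfolding lim_sequentially
  proof (intro allI impI)
    fix e :: real assume "0 < e"
    then obtain n where n: "r n < e / 10"
      using r_small[of "e / 10"] by auto
    obtain \<delta> where "0 < \<delta>" and \<delta>: "z \<in> approx_points f f' (r n) \<delta>"
      using has_derivative_imp_approx_points[of f f', OF deriv[OF z] r] by blast
    obtain k where k: "r k < \<delta>"
      using r_small[OF \<open>0 < \<delta>\<close>] by blast
    \<comment> \<open>\<open>N \<ge> n\<close> makes \<open>C n N\<close> one of the sets considered
      in \<open>U N\<close>; \<open>N \<ge> k\<close> brings the scale \<open>r N\<close> below
      \<delta>, so that \<open>z\<close> belongs to \<open>C n N\<close>.\<close>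
    have "dist (F N z) (f' z) < e" if N: "N \<ge> max n k" for N
    proof -
      have "r N \<le> \<delta>"
        using r_anti[of k N] k N by simp
      then have zC: "z \<in> C n N"
        using \<delta> approx_points_mono closure_subset unfolding C_def by blast
      have "dist (F N z) (f' z) \<le> 10 * r n"
      proof (rule F[OF z])
        fix x assume x: "x \<in> S" "z \<in> U N x"
        then have "dist x z < r N / 8" "x \<in> C n N"
          using zC N by (auto simp: U_def)
        then show "dist (f' x) (f' z) \<le> 10 * r n"
          using deriv x(1) z zC r[of n] unfolding C_def
          by (intro deriv_oscillation_on_closure_approx_points) auto
      qed
      then show ?thesis
        using n by simp
    qed
    then show "\<exists>no. \<forall>N\<ge>no. dist (F N z) (f' z) < e"
      by blast
  qed
  then show ?thesis
    using contF unfolding first_Baire_class_on_def by blast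
qed

text \<open>\<open>Blinfun\<close> is inverse to \<open>blinfun_apply\<close> only on bounded linear
  maps, and boundedness is part of \<open>has_derivative\<close>.\<close>

lemma has_derivative_frechet_deriv:
  assumes "f differentiable (at x)"
  shows "(f has_derivative frechet_deriv f x) (at x)"
proof -
  have "(f has_derivative frechet_derivative f (at x)) (at x)"
    using assms frechet_derivative_works by blast
  then show ?thesis
    by (simp add: frechet_deriv_def bounded_linear_Blinfun_apply has_derivative_bounded_linear)
qed

theorem theorem3p1:
  fixes f :: "'a::real_normed_vector \<Rightarrow> 'b::banach"
    and G :: "'a set"
  assumes "open G"
  shows "first_Baire_class_on (differentiability_set f G) (frechet_deriv f)"
  by (rule first_Baire_class_on_derivative[where f = f])
    (simp add: differentiability_set_def has_derivative_frechet_deriv)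

end
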